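(* Fix constants $0<p_2<p_1<1$. Suppose $c=c(s)>1$ is such that for all $s,d\in\mathbb{N}$, all $r>0$ and every distribution $\mu$ on $\mathsf{EMD}_s(\{0,1\}^d)$ there exists a hash family which is $(r,c(s)\,r,p_1,p_2)$-sensitive for $\mu$ over $\mathsf{EMD}_s(\{0,1\}^d)$. Then $c(s)=\Omega(\log s)$.
   Context: $\mathsf{EMD}_s(\{0,1\}^d)$ consists of multisets of $s$ vectors of $\{0,1\}^d$ with $\mathsf{EMD}(x,y)=\min_{\pi}\sum_{i=1}^s\|x_i-y_{\pi(i)}\|_1$ over bijections $\pi:[s]\to[s]$. A distribution $\mathcal D$ over maps $h:\mathsf{EMD}_s(\{0,1\}^d)\to U$ is $(r,cr,p_1,p_2)$-sensitive for $\mu$ if (1) $\Pr_{h}[h(x)=h(y)]\ge p_1$ whenever $\mathsf{EMD}(x,y)\le r$, and (2) for every $x$, $\Pr_{h\sim\mathcal D,y\sim\mu}[\mathsf{EMD}(x,y)>cr\text{ and }h(x)=h(y)]\le p_2$. The implicit constant in $\Omega(\cdot)$ may depend on $p_1,p_2$. *)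

theory Defs
  imports "HOL-Probability.Probability" "HOL-Combinatorics.Permutations"
begin

definition cube :: "nat \<Rightarrow> (nat \<Rightarrow> real) set" where
  "cube d = {..<d} \<rightarrow>\<^sub>E {0, 1}"

definition l1_dist :: "nat \<Rightarrow> (nat \<Rightarrow> real) \<Rightarrow> (nat \<Rightarrow> real) \<Rightarrow> real" where
  "l1_dist d u v = (\<Sum>j<d. \<bar>u j - v j\<bar>)"

definition EMD_space :: "nat \<Rightarrow> nat \<Rightarrow> (nat \<Rightarrow> real) multiset set" where
  "EMD_space s d = {X. size X = s \<and> set_mset X \<subseteq> cube d}"

(* The lists xs, ys are enumerations x_1,...,x_s and y_1,...,y_s of the two multisets.
   The minimum over bijections does not depend on which enumerations are used, so it is
   harmless to minimise over them as well; the lemma emd_mset below makes this explicit. *)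
definition emd :: "nat \<Rightarrow> (nat \<Rightarrow> real) multiset \<Rightarrow> (nat \<Rightarrow> real) multiset \<Rightarrow> real" where
  "emd d X Y = Min {\<Sum>i<size X. l1_dist d (xs ! i) (ys ! \<pi> i) | xs ys \<pi>.
     mset xs = X \<and> mset ys = Y \<and> \<pi> permutes {..<size X}}"

lemma emd_mset:
  assumes len: "length xs = s" "length ys = s"
  shows "emd d (mset xs) (mset ys) =
    Min {\<Sum>i<s. l1_dist d (xs ! i) (ys ! \<pi> i) | \<pi>. \<pi> permutes {..<s}}"
proof -
  have "{\<Sum>i<s. l1_dist d (xs' ! i) (ys' ! \<pi> i) | xs' ys' \<pi>.
      mset xs' = mset xs \<and> mset ys' = mset ys \<and> \<pi> permutes {..<s}}
    = {\<Sum>i<s. l1_dist d (xs ! i) (ys ! \<pi> i) | \<pi>. \<pi> permutes {..<s}}" (is "?A = ?B")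
  proof
    show "?B \<subseteq> ?A" by blast
    show "?A \<subseteq> ?B"
    proof
      fix t assume "t \<in> ?A"
      then obtain xs' ys' \<pi> where t: "t = (\<Sum>i<s. l1_dist d (xs' ! i) (ys' ! \<pi> i))"
        and m: "mset xs' = mset xs" "mset ys' = mset ys" and p: "\<pi> permutes {..<s}"
        by blast
      obtain f where f: "f permutes {..<s}" "permute_list f xs = xs'"
        using mset_eq_permutation[OF m(1)] len by metis
      obtain g where g: "g permutes {..<s}" "permute_list g ys = ys'"
        using mset_eq_permutation[OF m(2)] len by metis
      define \<rho> where "\<rho> = g \<circ> \<pi> \<circ> inv f"
      have \<rho>: "\<rho> permutes {..<s}"
        unfolding \<rho>_def by (intro permutes_compose permutes_inv f g p)
      have "t = (\<Sum>i<s. l1_dist d (xs ! f i) (ys ! \<rho> (f i)))"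
        unfolding t
      proof (rule sum.cong[OF refl])
        fix i assume "i \<in> {..<s}"
        then have i: "i < s" and pi: "\<pi> i < s" using permutes_in_image[OF p] by auto
        have "xs' ! i = xs ! f i"
          using permute_list_nth[of f xs i] f i len by auto
        moreover have "ys' ! \<pi> i = ys ! g (\<pi> i)"
          using permute_list_nth[of g ys "\<pi> i"] g pi len by auto
        moreover have "\<rho> (f i) = g (\<pi> i)"
          by (simp add: \<rho>_def permutes_inverses(2)[OF f(1)])
        ultimately show "l1_dist d (xs' ! i) (ys' ! \<pi> i) = l1_dist d (xs ! f i) (ys ! \<rho> (f i))"
          by simp
      qed
      also have "\<dots> = (\<Sum>i<s. l1_dist d (xs ! i) (ys ! \<rho> i))"
        using sum.permute[OF f(1), of "\<lambda>i. l1_dist d (xs ! i) (ys ! \<rho> i)"] by (simp add: o_def)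
      finally show "t \<in> ?B" using \<rho> by blast
    qed
  qed
  then show ?thesis using len by (simp add: emd_def)
qed

(* D is a probability measure on maps h with values in the type 'u, which plays the role of
   the range U. Values of h outside EMD_space s d are irrelevant. The sigma-algebra is
   arbitrary, subject to the collision events being measurable; since EMD_space s d is finite,
   this also makes the event in the second condition of sensitive measurable. *)
definition hash_family ::
  "nat \<Rightarrow> nat \<Rightarrow> ((nat \<Rightarrow> real) multiset \<Rightarrow> 'u) measure \<Rightarrow> bool" where
  "hash_family s d D \<longleftrightarrow> prob_space D \<and>
     (\<forall>x\<in>EMD_space s d. \<forall>y\<in>EMD_space s d. {h \<in> space D. h x = h y} \<in> sets D)"

(* (r, R, p1, p2)-sensitivity. In the second condition h and y are drawn independently. The
   conjunct "y \<in> EMD_space s d" holds almost surely, as mu is supported on EMD_space s d. *)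
definition sensitive ::
  "nat \<Rightarrow> nat \<Rightarrow> (nat \<Rightarrow> real) multiset pmf \<Rightarrow> ((nat \<Rightarrow> real) multiset \<Rightarrow> 'u) measure \<Rightarrow>
     real \<Rightarrow> real \<Rightarrow> real \<Rightarrow> real \<Rightarrow> bool" where
  "sensitive s d \<mu> D r R p1 p2 \<longleftrightarrow> hash_family s d D \<and>
     (\<forall>x\<in>EMD_space s d. \<forall>y\<in>EMD_space s d. emd d x y \<le> r \<longrightarrow>
        \<P>(h in D. h x = h y) \<ge> p1) \<and>
     (\<forall>x\<in>EMD_space s d.
        \<P>((h, y) in D \<Otimes>\<^sub>M measure_pmf \<mu>. y \<in> EMD_space s d \<and> emd d x y > R \<and> h x = h y) \<le> p2)"

end

theory Submission
  imports Defs
begin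

text \<open>
  The argument is the Fourier-analytic one of Khot and Naor. Identify the subsets of \<open>{..<d}\<close> with
  the vector space \<open>F\<^sub>2\<^sup>d\<close>, where \<open>d = 2 m\<close> and \<open>2 ^ m \<le> s < 2 ^ (m + 1)\<close>, and choose a linear code
  spanned by \<open>m\<close> words whose dual code has minimum distance at least \<open>d / 16\<close>. Send a point \<open>y\<close> to
  the translate of the code by \<open>y\<close>, regarded as a multiset. Moving \<open>y\<close> by \<open>k\<close> coordinates changes
  this multiset by at most \<open>2 ^ m k\<close>, but most pairs of translates are at distance at least
  \<open>2 ^ m m / 8\<close>, since there are too few code words to cover the cube by balls of radius \<open>m / 8\<close>.
  The collision kernel of a hash family is positive semidefinite and invariant under the code, so
  its translation average has nonnegative Fourier coefficients supported on the dual code. A lazy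
  random walk of \<open>k\<close> steps multiplies the nonconstant ones by at most \<open>(15 / 16) ^ k\<close>. Thus \<open>p1\<close>
  exceeds the average collision probability by at most \<open>(15 / 16) ^ k\<close>, while that average exceeds
  \<open>p2\<close> by at most \<open>(93 / 100) ^ m\<close> if \<open>c k < m / 8\<close>.
\<close>

section \<open>Characters of the cube\<close>

definition symd :: "'a set \<Rightarrow> 'a set \<Rightarrow> 'a set" (infixl "\<oplus>" 65)
  where "A \<oplus> B = (A - B) \<union> (B - A)"

lemma symd_self [simp]: "A \<oplus> A = {}"
  by (simp add: symd_def)

lemma symd_commute: "A \<oplus> B = B \<oplus> A"
  and symd_assoc: "(A \<oplus> B) \<oplus> C = A \<oplus> (B \<oplus> C)"
  and symd_left_commute: "A \<oplus> (B \<oplus> C) = B \<oplus> (A \<oplus> C)"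
  and symd_cancel [simp]: "A \<oplus> (A \<oplus> B) = B"
  and symd_empty [simp]: "A \<oplus> {} = A" "{} \<oplus> A = A"
  and symd_subset: "A \<subseteq> U \<Longrightarrow> B \<subseteq> U \<Longrightarrow> A \<oplus> B \<subseteq> U"
  by (auto simp: symd_def)

lemma symd_eq_empty_iff: "A \<oplus> B = {} \<longleftrightarrow> A = B"
  by (auto simp: symd_def)

lemmas symd_ac = symd_assoc symd_commute symd_left_commute

lemma card_symd_le: "finite A \<Longrightarrow> finite B \<Longrightarrow> card (A \<oplus> B) \<le> card A + card B"
  unfolding symd_def
  by (meson Diff_subset add_mono card_Un_le card_mono order_trans)

lemma sum_symd:
  assumes "a \<subseteq> U"
  shows "(\<Sum>z\<in>Pow U. f (a \<oplus> z)) = (\<Sum>z\<in>Pow U. f z)"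
  by (rule sum.reindex_bij_witness[of _ "(\<oplus>) a" "(\<oplus>) a"])
    (use assms in \<open>auto dest: symd_subset[OF assms]\<close>)

text \<open>The Walsh character of frequency \<open>S\<close>, evaluated at
  \<open>z\<close>.\<close>

definition chi :: "'a set \<Rightarrow> 'a set \<Rightarrow> real"
  where "chi S z = (- 1) ^ card (S \<inter> z)"

lemma chi_commute: "chi S z = chi z S"
  by (simp add: chi_def Int_commute)

lemma chi_empty [simp]: "chi S {} = 1" "chi {} S = 1"
  by (simp_all add: chi_def)

text \<open>The parity of the intersection with \<open>S\<close> is additive: points common to
  \<open>z\<close> and \<open>w\<close> are counted twice on one side and not at all on the
  other.\<close>

lemma chi_symd:
  assumes "finite S"
  shows "chi S (z \<oplus> w) = chi S z * chi S w"
proof -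
  define A B where "A = S \<inter> z" and "B = S \<inter> w"
  have fin: "finite A" "finite B"
    using assms by (auto simp: A_def B_def)
  have "card A = card (A - B) + card (A \<inter> B)" "card B = card (B - A) + card (A \<inter> B)"
    using fin card_Int_Diff[of A B] card_Int_Diff[of B A] by (auto simp: Int_commute)
  moreover have "card (A \<oplus> B) = card (A - B) + card (B - A)"
    unfolding symd_def using fin by (intro card_Un_disjoint) auto
  moreover have "S \<inter> (z \<oplus> w) = A \<oplus> B"
    by (auto simp: symd_def A_def B_def)
  ultimately show ?thesis
    by (simp add: chi_def A_def[symmetric] B_def[symmetric] power_add)
qed

text \<open>For nonempty \<open>S\<close>, translation by a point of \<open>S\<close> permutes the
  terms and flips every sign, so the sum is its own negative.\<close>

lemma sum_chi:
  assumes "finite U" "S \<subseteq> U"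
  shows "(\<Sum>z\<in>Pow U. chi S z) = (if S = {} then 2 ^ card U else 0)"
proof (cases "S = {}")
  case True
  then show ?thesis using assms by (simp add: card_Pow)
next
  case False
  then obtain i where i: "i \<in> S" by auto
  have "(\<Sum>z\<in>Pow U. chi S z) = (\<Sum>z\<in>Pow U. chi S ({i} \<oplus> z))"
    using i assms by (intro sum_symd[symmetric]) auto
  also have "\<dots> = - (\<Sum>z\<in>Pow U. chi S z)"
    using i assms finite_subset[OF assms(2)]
    by (simp add: chi_symd sum_negf[symmetric]) (simp add: chi_def)
  finally show ?thesis using False by simp
qed

text \<open>By averaging, some \<open>c\<close> separates at least half of the sets in the family; iterate.\<close>
lemma exists_odd_basis:
  assumes "finite U" "B \<subseteq> Pow U - {{}}" "card B < 2 ^ m"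
  shows "\<exists>cs. length cs = m \<and> set cs \<subseteq> Pow U \<and> (\<forall>S\<in>B. \<exists>c\<in>set cs. odd (card (S \<inter> c)))"
  using assms(2,3)
proof (induction m arbitrary: B)
  case 0
  have "finite B" using 0 assms(1) by (meson finite_Diff finite_Pow_iff finite_subset)
  then show ?case using 0 by auto
next
  case (Suc m)
  have fB: "finite B" using Suc.prems assms(1) by (meson finite_Diff finite_Pow_iff finite_subset)
  \<comment> \<open>Each \<open>S\<close> in \<open>B\<close> is nonempty, so orthogonality
    annihilates every inner sum after the exchange; hence the average over \<open>c\<close> is
    zero.\<close>
  have "(\<Sum>c\<in>Pow U. \<Sum>S\<in>B. chi S c) = (\<Sum>S\<in>B. \<Sum>c\<in>Pow U. chi S c)"
    by (rule sum.swap)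
  also have "\<dots> = 0"
    using Suc.prems(1) by (intro trans[OF sum.cong[OF refl sum_chi[OF assms(1)]]]) (auto intro!: sum.neutral)
  finally have "\<exists>c\<in>Pow U. (\<Sum>S\<in>B. chi S c) \<le> 0"
    using sum_pos[of "Pow U" "\<lambda>c. \<Sum>S\<in>B. chi S c"] assms(1) by (force simp: not_le)
  then obtain c where c: "c \<subseteq> U" "(\<Sum>S\<in>B. chi S c) \<le> 0" by auto
  \<comment> \<open>The sets in \<open>E\<close> are not yet separated by \<open>c\<close> and are
    left to the other \<open>m\<close> words.\<close>
  define E where "E = {S\<in>B. even (card (S \<inter> c))}"
  have E: "E \<subseteq> B" by (auto simp: E_def)
  have "(\<Sum>S\<in>B. chi S c) = (\<Sum>S\<in>E. chi S c) + (\<Sum>S\<in>B - E. chi S c)"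
    using fB E by (metis add.commute sum.subset_diff)
  also have "(\<Sum>S\<in>E. chi S c) = card E"
    by (simp add: E_def chi_def)
  also have "(\<Sum>S\<in>B - E. chi S c) = - real (card (B - E))"
    by (simp add: E_def chi_def)
  finally have "card E \<le> card (B - E)" using c by linarith
  moreover have "card B = card E + card (B - E)"
    using E fB by (metis card_Diff_subset card_mono finite_subset le_add_diff_inverse)
  ultimately have "card E < 2 ^ m" using Suc.prems by simp
  moreover have "E \<subseteq> Pow U - {{}}" using E Suc.prems by auto
  ultimately obtain cs where cs: "length cs = m" "set cs \<subseteq> Pow U"
      "\<forall>S\<in>E. \<exists>c\<in>set cs. odd (card (S \<inter> c))"
    using Suc.IH by blast
  show ?case
    by (rule exI[of _ "c # cs"]) (use cs c in \<open>auto simp: E_def\<close>)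
qed

text \<open>A Chernoff-type bound: as \<open>x \<le> 1\<close>, each counted set contributes at
  least \<open>x ^ t\<close> to the binomial expansion of \<open>(1 + x) ^ card U\<close>.\<close>

lemma card_small_subsets:
  fixes x :: real
  assumes "finite U" "0 < x" "x \<le> 1"
  shows "real (card {S\<in>Pow U. card S \<le> t}) * x ^ t \<le> (1 + x) ^ card U"
proof -
  have "real (card {S\<in>Pow U. card S \<le> t}) * x ^ t = (\<Sum>S\<in>{S\<in>Pow U. card S \<le> t}. x ^ t)"
    by simp
  also have "\<dots> \<le> (\<Sum>S\<in>{S\<in>Pow U. card S \<le> t}. x ^ card S)"
    using assms by (intro sum_mono power_decreasing) auto
  also have "\<dots> \<le> (\<Sum>S\<in>Pow U. x ^ card S)"
    using assms by (intro sum_mono2) auto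
  also have "\<dots> = (1 + x) ^ card U"
    using prod_add[OF assms(1), of "\<lambda>_. x" "\<lambda>_. 1"] by (simp add: add.commute)
  finally show ?thesis .
qed

text \<open>A lazy step stays at \<open>z\<close> with probability 1/2 and otherwise flips a uniform
  coordinate. It multiplies the coefficient at \<open>S\<close> by \<open>1 - card S / d\<close> and
  leads from \<open>card z \<le> k\<close> to at most \<open>Suc k\<close>, so the hypothesis passes
  to the damped coefficients. The induction therefore generalizes over \<open>a\<close>.\<close>

lemma noise_bound:
  fixes a :: "nat set \<Rightarrow> real"
  assumes "d > 0"
    and "\<And>z. z \<subseteq> {..<d} \<Longrightarrow> card z \<le> k \<Longrightarrow> p \<le> (\<Sum>S\<in>Pow {..<d}. a S * chi S z)"
  shows "p \<le> (\<Sum>S\<in>Pow {..<d}. a S * (1 - card S / d) ^ k)"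
  using assms(2)
proof (induction k arbitrary: a)
  case 0
  from 0[of "{}"] show ?case by simp
next
  case (Suc k)
  define f where "f z = (\<Sum>S\<in>Pow {..<d}. a S * chi S z)" for z
  have "p \<le> (\<Sum>S\<in>Pow {..<d}. (a S * (1 - card S / d)) * chi S z)"
    if z: "z \<subseteq> {..<d}" "card z \<le> k" for z
  proof -
    have fz: "finite z" using z finite_subset by blast
    \<comment> \<open>Characters are eigenfunctions of the sum over the \<open>d\<close> neighbours
      of a point.\<close>
    have step: "(\<Sum>i<d. chi S ({i} \<oplus> z)) = (real d - 2 * real (card S)) * chi S z" if "S \<subseteq> {..<d}" for S
    proof -
      have fS: "finite S" using that finite_subset by blast
      have "(\<Sum>i<d. chi S {i}) = (\<Sum>i<d. 1 - (if i \<in> S then 2 else 0))"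
        by (intro sum.cong) (auto simp: chi_def)
      also have "\<dots> = d - 2 * real (card S)"
        using that by (simp add: sum_subtractf sum.If_cases Int_absorb1)
      finally show ?thesis
        by (simp add: chi_symd[OF fS] sum_distrib_right[symmetric])
    qed
    have "(\<Sum>i<d. p) \<le> (\<Sum>i<d. f ({i} \<oplus> z))"
    proof (rule sum_mono)
      fix i assume i: "i \<in> {..<d}"
      have "card ({i} \<oplus> z) \<le> Suc k"
        using card_symd_le[of "{i}" z] fz z by simp
      then show "p \<le> f ({i} \<oplus> z)"
        unfolding f_def using i z by (intro Suc.prems symd_subset) auto
    qed
    also have "\<dots> = (\<Sum>S\<in>Pow {..<d}. a S * (\<Sum>i<d. chi S ({i} \<oplus> z)))"
      unfolding f_def by (subst sum.swap) (simp add: sum_distrib_left)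
    also have "\<dots> = (\<Sum>S\<in>Pow {..<d}. a S * ((real d - 2 * real (card S)) * chi S z))"
      by (intro sum.cong) (auto simp: step)
    finally have 1: "d * p \<le> (\<Sum>S\<in>Pow {..<d}. a S * ((real d - 2 * real (card S)) * chi S z))"
      by simp
    \<comment> \<open>Laziness: \<open>z\<close> gets the same total weight \<open>d\<close> as its
      neighbours together, which shifts the eigenvalue to \<open>2 * (d - card S)\<close>,
      nonnegative for \<open>S\<close> within \<open>{..<d}\<close>.\<close>
    have "p \<le> f z" unfolding f_def using z by (intro Suc.prems) auto
    then have "2 * d * p \<le> d * f z + (\<Sum>S\<in>Pow {..<d}. a S * ((real d - 2 * real (card S)) * chi S z))"
      using 1 mult_left_mono[of p "f z" "real d"] by simp
    also have "\<dots> = 2 * d * (\<Sum>S\<in>Pow {..<d}. (a S * (1 - card S / d)) * chi S z)"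
      unfolding f_def sum_distrib_left sum.distrib[symmetric]
      using assms(1) by (intro sum.cong) (auto simp: field_simps)
    finally show ?thesis using assms(1) by simp
  qed
  from Suc.IH[of "\<lambda>S. a S * (1 - card S / d)", OF this]
  show ?case by (simp add: mult.assoc)
qed

section \<open>Fourier inversion and kernels of positive type\<close>

lemma fourier_inversion:
  fixes g :: "'a set \<Rightarrow> real"
  assumes "finite U" "z \<subseteq> U"
  shows "(\<Sum>S\<in>Pow U. (\<Sum>w\<in>Pow U. g w * chi S w) / 2 ^ card U * chi S z) = g z"
proof -
  have "(\<Sum>S\<in>Pow U. (\<Sum>w\<in>Pow U. g w * chi S w) / 2 ^ card U * chi S z)
      = (\<Sum>w\<in>Pow U. \<Sum>S\<in>Pow U. g w / 2 ^ card U * (chi S w * chi S z))"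
    unfolding sum_distrib_right sum_divide_distrib by (subst sum.swap) (simp add: mult_ac)
  \<comment> \<open>By the symmetry of \<open>chi\<close>, the sum over frequencies is an
    orthogonality sum for the frequency \<open>w \<oplus> z\<close>, which is nonzero only at
    \<open>w = z\<close>.\<close>
  also have "\<dots> = (\<Sum>w\<in>Pow U. g w / 2 ^ card U * (\<Sum>S\<in>Pow U. chi (w \<oplus> z) S))"
  proof (intro sum.cong refl, subst sum_distrib_left, intro sum.cong refl)
    fix w S assume "S \<in> Pow U"
    then have "finite S" using assms(1) finite_subset by blast
    then show "g w / 2 ^ card U * (chi S w * chi S z) = g w / 2 ^ card U * chi (w \<oplus> z) S"
      by (simp add: chi_symd[symmetric] chi_commute)
  qed
  also have "\<dots> = (\<Sum>w\<in>Pow U. if w = z then g w else 0)"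
    using assms by (intro sum.cong refl, subst sum_chi) (auto intro: symd_subset[THEN subsetD] simp: symd_eq_empty_iff)
  also have "\<dots> = g z" using assms by simp
  finally show ?thesis .
qed

text \<open>Averaging the kernel over translations gives a function of positive type on the cube.
  Invariance under \<open>C\<close> kills its low nonzero frequencies, and noise damps the high ones.\<close>
lemma kernel_bound:
  fixes K :: "nat set \<Rightarrow> nat set \<Rightarrow> real" and \<delta> p :: real
  assumes d: "d > 0" and \<delta>: "\<delta> \<le> 1"
    and diag: "\<And>x. x \<subseteq> {..<d} \<Longrightarrow> K x x = 1"
    and psd: "\<And>f. 0 \<le> (\<Sum>x\<in>Pow {..<d}. \<Sum>y\<in>Pow {..<d}. f x * f y * K x y)"
    and C: "C \<subseteq> Pow {..<d}"
    and inv: "\<And>x y c. x \<subseteq> {..<d} \<Longrightarrow> y \<subseteq> {..<d} \<Longrightarrow> c \<in> C \<Longrightarrow> K x (c \<oplus> y) = K x y"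
    and odd: "\<And>S. S \<subseteq> {..<d} \<Longrightarrow> S \<noteq> {} \<Longrightarrow> card S < \<delta> * d \<Longrightarrow> \<exists>c\<in>C. odd (card (S \<inter> c))"
    and close: "\<And>x z. x \<subseteq> {..<d} \<Longrightarrow> z \<subseteq> {..<d} \<Longrightarrow> card z \<le> k \<Longrightarrow> p \<le> K x (x \<oplus> z)"
  shows "p \<le> (\<Sum>x\<in>Pow {..<d}. \<Sum>y\<in>Pow {..<d}. K x y) / 4 ^ d + (1 - \<delta>) ^ k"
proof -
  let ?Q = "Pow {..<d}"
  define \<kappa> where "\<kappa> z = (\<Sum>x\<in>?Q. K x (x \<oplus> z)) / 2 ^ d" for z
  define a where "a S = (\<Sum>z\<in>?Q. \<kappa> z * chi S z) / 2 ^ d" for S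
  have four: "(4::real) ^ d = 2 ^ d * 2 ^ d" by (simp flip: power_mult_distrib)
  have card_Q: "card ?Q = 2 ^ d" by (simp add: card_Pow)
  have inversion: "(\<Sum>S\<in>?Q. a S * chi S z) = \<kappa> z" if "z \<subseteq> {..<d}" for z
    using fourier_inversion[of "{..<d}" z \<kappa>] that by (simp add: a_def)
  \<comment> \<open>The diagonal of \<open>K\<close> gives the coefficients \<open>a\<close> total
    mass 1; with \<open>a_nonneg\<close> below they are probability weights.\<close>
  have "\<kappa> {} = 1" using card_Q by (simp add: \<kappa>_def diag)
  then have sum_a: "(\<Sum>S\<in>?Q. a S) = 1" using inversion[of "{}"] by simp
  have a_eq: "a S = (\<Sum>x\<in>?Q. \<Sum>y\<in>?Q. chi S x * chi S y * K x y) / 4 ^ d" if S: "S \<subseteq> {..<d}" for S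
  proof -
    have fS: "finite S" using S finite_subset by blast
    have "(\<Sum>z\<in>?Q. \<kappa> z * chi S z) = (\<Sum>z\<in>?Q. \<Sum>x\<in>?Q. K x (x \<oplus> z) * chi S z) / 2 ^ d"
      by (simp add: \<kappa>_def sum_distrib_right sum_divide_distrib)
    also have "(\<Sum>z\<in>?Q. \<Sum>x\<in>?Q. K x (x \<oplus> z) * chi S z)
        = (\<Sum>x\<in>?Q. \<Sum>z\<in>?Q. K x (x \<oplus> z) * chi S (x \<oplus> (x \<oplus> z)))"
      by (subst sum.swap) simp
    also have "\<dots> = (\<Sum>x\<in>?Q. \<Sum>y\<in>?Q. K x y * chi S (x \<oplus> y))"
      by (intro sum.cong refl sum_symd) auto
    finally show ?thesis using fS by (simp add: a_def four chi_symd mult_ac)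
  qed
  have a_nonneg: "0 \<le> a S" if "S \<subseteq> {..<d}" for S
    using psd[of "chi S"] that by (simp add: a_eq)
  \<comment> \<open>Translation by a code word \<open>c\<close> fixes \<open>\<kappa>\<close> but
    reverses the sign of \<open>chi S\<close> when \<open>S\<close> meets \<open>c\<close> in an odd
    number of points.\<close>
  have a_zero: "a S = 0" if S: "S \<subseteq> {..<d}" "S \<noteq> {}" "card S < \<delta> * d" for S
  proof -
    have fS: "finite S" using S finite_subset by blast
    obtain c where c: "c \<in> C" "odd (card (S \<inter> c))" using odd[OF S] by auto
    then have cd: "c \<subseteq> {..<d}" using C by auto
    have "(\<Sum>z\<in>?Q. \<kappa> z * chi S z) = (\<Sum>z\<in>?Q. \<kappa> (c \<oplus> z) * chi S (c \<oplus> z))"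
      using cd by (intro sum_symd[symmetric])
    also have "\<dots> = (\<Sum>z\<in>?Q. - (\<kappa> z * chi S z))"
    proof (intro sum.cong refl)
      fix z assume z: "z \<in> ?Q"
      have "K x (x \<oplus> (c \<oplus> z)) = K x (x \<oplus> z)" if "x \<subseteq> {..<d}" for x
        using inv[OF that symd_subset[OF that] c(1), of z] z by (simp add: symd_left_commute)
      then have "\<kappa> (c \<oplus> z) = \<kappa> z" by (simp add: \<kappa>_def)
      moreover have "chi S c = -1" using c by (simp add: chi_def)
      ultimately show "\<kappa> (c \<oplus> z) * chi S (c \<oplus> z) = - (\<kappa> z * chi S z)"
        by (simp add: chi_symd[OF fS])
    qed
    finally show ?thesis by (simp add: a_def sum_negf)
  qed
  have "p \<le> (\<Sum>S\<in>?Q. a S * (1 - card S / d) ^ k)"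
  proof (rule noise_bound[OF d])
    fix z assume z: "z \<subseteq> {..<d}" "card z \<le> k"
    have "(\<Sum>x\<in>?Q. p) \<le> (\<Sum>x\<in>?Q. K x (x \<oplus> z))"
      using z by (intro sum_mono close) auto
    then have "p \<le> \<kappa> z" using card_Q by (simp add: \<kappa>_def field_simps)
    then show "p \<le> (\<Sum>S\<in>?Q. a S * chi S z)" using inversion z by simp
  qed
  also have "\<dots> = a {} + (\<Sum>S\<in>?Q - {{}}. a S * (1 - card S / d) ^ k)"
    by (subst sum.remove[of _ "{}"]) auto
  also have "(\<Sum>S\<in>?Q - {{}}. a S * (1 - card S / d) ^ k) \<le> (\<Sum>S\<in>?Q - {{}}. a S * (1 - \<delta>) ^ k)"
  proof (rule sum_mono)
    fix S assume S: "S \<in> ?Q - {{}}"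
    show "a S * (1 - card S / d) ^ k \<le> a S * (1 - \<delta>) ^ k"
    proof (cases "card S < \<delta> * d")
      case True
      then show ?thesis using a_zero S by auto
    next
      case False
      \<comment> \<open>This keeps the base \<open>1 - card S / d\<close> nonnegative, so that its
        powers are monotone.\<close>
      have "card S \<le> d" using S by (metis Diff_iff Pow_iff card_lessThan card_mono finite_lessThan)
      then show ?thesis using False d S
        by (intro mult_left_mono power_mono a_nonneg) (auto simp: field_simps)
    qed
  qed
  also have "\<dots> \<le> (\<Sum>S\<in>?Q. a S * (1 - \<delta>) ^ k)"
    using \<delta> by (intro sum_mono2) (auto intro!: mult_nonneg_nonneg a_nonneg)
  also have "\<dots> = (1 - \<delta>) ^ k" using sum_a by (simp flip: sum_distrib_right)
  \<comment> \<open>The coefficient at the empty frequency is the overall average of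
    \<open>K\<close>.\<close>
  finally show ?thesis using a_eq[of "{}"] by simp
qed

section \<open>Translates of a code under the earth mover distance\<close>

text \<open>A list instead of a set: dependent words lead to repeated entries, so the length is
  \<open>2 ^ length cs\<close> in every case.\<close>

primrec span_list :: "'a set list \<Rightarrow> 'a set list" where
  "span_list [] = [{}]"
| "span_list (c # cs) = span_list cs @ map ((\<oplus>) c) (span_list cs)"

lemma length_span_list: "length (span_list cs) = 2 ^ length cs"
  by (induction cs) auto

lemma span_list_subset: "set cs \<subseteq> Pow U \<Longrightarrow> set (span_list cs) \<subseteq> Pow U"
  by (induction cs) (force simp: symd_def)+

lemma span_list_closed:
  "u \<in> set (span_list cs) \<Longrightarrow> v \<in> set (span_list cs) \<Longrightarrow> u \<oplus> v \<in> set (span_list cs)"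
proof (induction cs arbitrary: u v)
  case Nil
  then show ?case by simp
next
  case (Cons c cs)
  let ?W = "set (span_list cs)"
  obtain u' a where u: "u' \<in> ?W" "a \<in> {{}, c}" "u = a \<oplus> u'"
  proof (cases "u \<in> ?W")
    case True
    then show ?thesis using that[of u "{}"] by simp
  next
    case False
    then show ?thesis using that[of _ c] Cons.prems(1) by auto
  qed
  obtain v' b where v: "v' \<in> ?W" "b \<in> {{}, c}" "v = b \<oplus> v'"
  proof (cases "v \<in> ?W")
    case True
    then show ?thesis using that[of v "{}"] by simp
  next
    case False
    then show ?thesis using that[of _ c] Cons.prems(2) by auto
  qed
  have "u \<oplus> v = (a \<oplus> b) \<oplus> (u' \<oplus> v')" using u v by (simp add: symd_ac)
  moreover have "a \<oplus> b \<in> {{}, c}" using u v by (auto simp: symd_def)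
  moreover have "u' \<oplus> v' \<in> ?W" using Cons.IH u v by blast
  ultimately show ?case by auto
qed

text \<open>Adding \<open>c\<close> swaps the two halves of the list built at the entry
  \<open>c\<close>, and it commutes with the translations at all other entries. Multiplicities are
  thus preserved.\<close>

lemma mset_span_list_shift:
  "c \<in> set cs \<Longrightarrow> mset (map ((\<oplus>) c) (span_list cs)) = mset (span_list cs)"
proof (induction cs)
  case Nil
  then show ?case by simp
next
  case (Cons b cs)
  show ?case
  proof (cases "c = b")
    case True
    then show ?thesis by (simp add: multiset.map_comp o_def)
  next
    case False
    then have "mset (map ((\<oplus>) c) (span_list cs)) = mset (span_list cs)" using Cons by simp
    moreover have "mset (map ((\<oplus>) c) (map ((\<oplus>) b) (span_list cs)))
        = image_mset ((\<oplus>) b) (mset (map ((\<oplus>) c) (span_list cs)))"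
      by (simp add: multiset.map_comp o_def symd_left_commute)
    ultimately show ?thesis by simp
  qed
qed

text \<open>The indicator vector, made extensional because \<open>cube\<close> consists of functions
  that are undefined outside \<open>{..<d}\<close>.\<close>

definition vec_of :: "nat \<Rightarrow> nat set \<Rightarrow> nat \<Rightarrow> real"
  where "vec_of d A = (\<lambda>i\<in>{..<d}. if i \<in> A then 1 else 0)"

lemma vec_of_in_cube: "vec_of d A \<in> cube d"
  by (auto simp: vec_of_def cube_def)

lemma l1_dist_vec_of:
  assumes "A \<subseteq> {..<d}" "B \<subseteq> {..<d}"
  shows "l1_dist d (vec_of d A) (vec_of d B) = card (A \<oplus> B)"
proof -
  have "l1_dist d (vec_of d A) (vec_of d B) = (\<Sum>j<d. if j \<in> A \<oplus> B then 1 else 0)"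
    unfolding l1_dist_def vec_of_def by (intro sum.cong) (auto simp: symd_def)
  also have "\<dots> = card ({..<d} \<inter> (A \<oplus> B))"
    by (subst sum.inter_restrict[symmetric]) auto
  also have "{..<d} \<inter> (A \<oplus> B) = A \<oplus> B"
    using assms by (auto simp: symd_def)
  finally show ?thesis .
qed

section \<open>Bounds on the earth mover distance from matchings and from Lipschitz
  functions\<close>

lemma l1_dist_self [simp]: "l1_dist d u u = 0"
  by (simp add: l1_dist_def)

lemma l1_dist_triangle: "l1_dist d u w \<le> l1_dist d u v + l1_dist d v w"
  unfolding l1_dist_def sum.distrib[symmetric] by (intro sum_mono) auto

lemma emd_le:
  assumes "length xs = s" "length ys = s"
  shows "emd d (mset xs) (mset ys) \<le> (\<Sum>i<s. l1_dist d (xs ! i) (ys ! i))"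
  unfolding emd_mset[OF assms]
proof (rule Min_le)
  show "finite {\<Sum>i<s. l1_dist d (xs ! i) (ys ! \<pi> i) | \<pi>. \<pi> permutes {..<s}}"
    using finite_permutations[of "{..<s}"] by simp
  show "(\<Sum>i<s. l1_dist d (xs ! i) (ys ! i))
      \<in> {\<Sum>i<s. l1_dist d (xs ! i) (ys ! \<pi> i) | \<pi>. \<pi> permutes {..<s}}"
    using permutes_id[of "{..<s}"] by (auto intro!: exI[of _ id])
qed

text \<open>The easy half of Kantorovich duality.\<close>
lemma emd_ge:
  assumes len: "length xs = s" "length ys = s"
    and lip: "\<And>u v. f v - f u \<le> l1_dist d u v"
  shows "sum_list (map f ys) - sum_list (map f xs) \<le> emd d (mset xs) (mset ys)"
  unfolding emd_mset[OF len]
proof (rule Min.boundedI)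
  show "finite {\<Sum>i<s. l1_dist d (xs ! i) (ys ! \<pi> i) | \<pi>. \<pi> permutes {..<s}}"
    using finite_permutations[of "{..<s}"] by simp
  show "{\<Sum>i<s. l1_dist d (xs ! i) (ys ! \<pi> i) | \<pi>. \<pi> permutes {..<s}} \<noteq> {}"
    using permutes_id[of "{..<s}"] by blast
  fix a assume "a \<in> {\<Sum>i<s. l1_dist d (xs ! i) (ys ! \<pi> i) | \<pi>. \<pi> permutes {..<s}}"
  then obtain \<pi> where \<pi>: "\<pi> permutes {..<s}" and a: "a = (\<Sum>i<s. l1_dist d (xs ! i) (ys ! \<pi> i))"
    by blast
  have "sum_list (map f ys) - sum_list (map f xs) = (\<Sum>i<s. f (ys ! i)) - (\<Sum>i<s. f (xs ! i))"
    using len by (simp add: sum_list_sum_nth atLeast0LessThan)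
  also have "(\<Sum>i<s. f (ys ! i)) = (\<Sum>i<s. f (ys ! \<pi> i))"
    using sum.permute[OF \<pi>, of "\<lambda>i. f (ys ! i)"] by (simp add: o_def)
  also have "\<dots> - (\<Sum>i<s. f (xs ! i)) \<le> a"
    unfolding a sum_subtractf[symmetric] by (intro sum_mono lip)
  finally show "sum_list (map f ys) - sum_list (map f xs) \<le> a" .
qed

text \<open>The zero vectors make up for \<open>s\<close> not being a power of two.\<close>
definition orbit_list :: "nat \<Rightarrow> nat \<Rightarrow> nat set list \<Rightarrow> nat set \<Rightarrow> (nat \<Rightarrow> real) list"
  where "orbit_list s d cs y = map (\<lambda>w. vec_of d (y \<oplus> w)) (span_list cs)
    @ replicate (s - 2 ^ length cs) (vec_of d {})"

definition orbit :: "nat \<Rightarrow> nat \<Rightarrow> nat set list \<Rightarrow> nat set \<Rightarrow> (nat \<Rightarrow> real) multiset"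
  where "orbit s d cs y = mset (orbit_list s d cs y)"

lemma length_orbit_list: "2 ^ length cs \<le> s \<Longrightarrow> length (orbit_list s d cs y) = s"
  by (simp add: orbit_list_def length_span_list)

lemma orbit_in_EMD_space: "2 ^ length cs \<le> s \<Longrightarrow> orbit s d cs y \<in> EMD_space s d"
  by (auto simp: EMD_space_def orbit_def length_orbit_list)
    (auto simp: orbit_list_def vec_of_in_cube split: if_splits)

text \<open>Translation by a generator only reorders the code; this makes the collision kernel
  invariant under the code.\<close>

lemma orbit_shift:
  assumes "c \<in> set cs"
  shows "orbit s d cs (c \<oplus> y) = orbit s d cs y"
proof -
  have "mset (map (\<lambda>w. vec_of d ((c \<oplus> y) \<oplus> w)) (span_list cs))
      = image_mset (\<lambda>w. vec_of d (y \<oplus> w)) (mset (map ((\<oplus>) c) (span_list cs)))"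
    by (simp add: multiset.map_comp o_def symd_ac)
  then show ?thesis
    by (simp add: orbit_def orbit_list_def mset_span_list_shift[OF assms] del: mset_map)
       (simp add: mset_span_list_shift[OF assms])
qed

text \<open>Match equal positions: the two entries belonging to one code word differ exactly by
  \<open>z\<close>, and the padding costs nothing.\<close>

lemma emd_orbit_le:
  assumes s: "2 ^ length cs \<le> s" and cs: "set cs \<subseteq> Pow {..<d}" and x: "x \<subseteq> {..<d}" and z: "z \<subseteq> {..<d}"
  shows "emd d (orbit s d cs x) (orbit s d cs (x \<oplus> z)) \<le> 2 ^ length cs * card z"
proof -
  let ?l = "orbit_list s d cs"
  have "emd d (orbit s d cs x) (orbit s d cs (x \<oplus> z)) \<le> (\<Sum>i<s. l1_dist d (?l x ! i) (?l (x \<oplus> z) ! i))"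
    unfolding orbit_def by (intro emd_le length_orbit_list s)
  also have "\<dots> = (\<Sum>i<s. if i < 2 ^ length cs then real (card z) else 0)"
  proof (intro sum.cong refl)
    fix i assume i: "i \<in> {..<s}"
    show "l1_dist d (?l x ! i) (?l (x \<oplus> z) ! i) = (if i < 2 ^ length cs then real (card z) else 0)"
    proof (cases "i < 2 ^ length cs")
      case True
      let ?w = "span_list cs ! i"
      have "?w \<in> set (span_list cs)" using True by (simp add: length_span_list)
      then have "?w \<subseteq> {..<d}" using span_list_subset[OF cs] by blast
      moreover have "(x \<oplus> ?w) \<oplus> ((x \<oplus> z) \<oplus> ?w) = z" by (simp add: symd_ac)
      ultimately show ?thesis using True x z
        by (simp add: orbit_list_def nth_append length_span_list l1_dist_vec_of symd_subset)
    next
      case False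
      then show ?thesis using i by (simp add: orbit_list_def nth_append length_span_list)
    qed
  qed
  also have "\<dots> = 2 ^ length cs * card z"
  proof -
    have "{..<s} \<inter> {i. i < 2 ^ length cs} = {..<2 ^ length cs}" using s by auto
    then show ?thesis by (simp add: sum.If_cases)
  qed
  finally show ?thesis by simp
qed

text \<open>The distance to the code translated by \<open>x\<close> is 1-Lipschitz, vanishes there, and the
  padding cancels.\<close>
lemma emd_orbit_ge:
  assumes s: "2 ^ length cs \<le> s" and cs: "set cs \<subseteq> Pow {..<d}" and x: "x \<subseteq> {..<d}" and y: "y \<subseteq> {..<d}"
    and far: "\<And>w. w \<in> set (span_list cs) \<Longrightarrow> \<tau> \<le> card (x \<oplus> (y \<oplus> w))"
  shows "2 ^ length cs * \<tau> \<le> emd d (orbit s d cs x) (orbit s d cs y)"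
proof -
  let ?W = "set (span_list cs)"
  have W: "?W \<noteq> {}" using length_span_list[of cs] by auto
  have Wd: "w \<subseteq> {..<d}" if "w \<in> ?W" for w using span_list_subset[OF cs] that by blast
  define f where "f v = Min ((\<lambda>w. l1_dist d (vec_of d (x \<oplus> w)) v) ` ?W)" for v
  have lip: "f v - f u \<le> l1_dist d u v" for u v
  proof -
    have "f u \<in> (\<lambda>w. l1_dist d (vec_of d (x \<oplus> w)) u) ` ?W"
      unfolding f_def using W by (intro Min_in) auto
    then obtain w where w: "w \<in> ?W" "f u = l1_dist d (vec_of d (x \<oplus> w)) u" by blast
    have "f v \<le> l1_dist d (vec_of d (x \<oplus> w)) v"
      unfolding f_def using w by (intro Min_le) auto
    then show ?thesis using w l1_dist_triangle[of d "vec_of d (x \<oplus> w)" v u] by simp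
  qed
  have "f (vec_of d (x \<oplus> w)) \<le> 0" if "w \<in> ?W" for w
    unfolding f_def using that by (subst Min_le_iff) (auto intro!: bexI[of _ w])
  then have X: "sum_list (map (\<lambda>w. f (vec_of d (x \<oplus> w))) (span_list cs)) \<le> 0"
    by (intro sum_list_nonpos) auto
  have "real \<tau> \<le> f (vec_of d (y \<oplus> w))" if w: "w \<in> ?W" for w
    unfolding f_def
  proof (rule Min.boundedI)
    fix a assume "a \<in> (\<lambda>w'. l1_dist d (vec_of d (x \<oplus> w')) (vec_of d (y \<oplus> w))) ` ?W"
    then obtain w' where w': "w' \<in> ?W" "a = l1_dist d (vec_of d (x \<oplus> w')) (vec_of d (y \<oplus> w))"
      by blast
    \<comment> \<open>The code is closed under addition, so the distance between two translated
      words is again covered by \<open>far\<close>.\<close>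
    have "a = card (x \<oplus> (y \<oplus> (w' \<oplus> w)))"
      using w' Wd[OF w] Wd[OF w'(1)] x y by (simp add: l1_dist_vec_of symd_subset symd_ac)
    then show "real \<tau> \<le> a" using far[OF span_list_closed[OF w'(1) w]] by simp
  qed (use W in auto)
  then have "sum_list (map (\<lambda>_. real \<tau>) (span_list cs))
      \<le> sum_list (map (\<lambda>w. f (vec_of d (y \<oplus> w))) (span_list cs))"
    by (intro sum_list_mono) auto
  then have "2 ^ length cs * real \<tau> \<le> sum_list (map (\<lambda>w. f (vec_of d (y \<oplus> w))) (span_list cs))"
    by (simp add: map_replicate_const sum_list_replicate length_span_list)
  also have "\<dots> \<le> sum_list (map f (orbit_list s d cs y)) - sum_list (map f (orbit_list s d cs x))"
    using X by (simp add: orbit_list_def o_def)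
  also have "\<dots> \<le> emd d (orbit s d cs x) (orbit s d cs y)"
    unfolding orbit_def
    using emd_ge[OF length_orbit_list[OF s] length_orbit_list[OF s] lip] .
  finally show ?thesis by simp
qed

text \<open>By \<open>emd_orbit_ge\<close>, a near \<open>y\<close> satisfies
  \<open>card (x \<oplus> (y \<oplus> w)) \<le> t\<close> for some code word \<open>w\<close>; so
  \<open>y\<close> is determined by \<open>w\<close> and a set of at most \<open>t\<close> elements.
  The factor \<open>t + 1\<close> reflects that cardinalities above \<open>t\<close> are at least
  \<open>t + 1\<close>.\<close>

lemma card_near_orbits:
  fixes R :: real
  assumes s: "2 ^ length cs \<le> s" and cs: "set cs \<subseteq> Pow {..<d}" and x: "x \<subseteq> {..<d}"
    and R: "R < 2 ^ length cs * (t + 1)"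
  shows "card {y\<in>Pow {..<d}. emd d (orbit s d cs x) (orbit s d cs y) \<le> R}
    \<le> 2 ^ length cs * card {b\<in>Pow {..<d}. card b \<le> t}"
proof -
  let ?W = "set (span_list cs)" and ?B = "{b\<in>Pow {..<d}. card b \<le> t}"
  have "{y\<in>Pow {..<d}. emd d (orbit s d cs x) (orbit s d cs y) \<le> R}
      \<subseteq> (\<lambda>(w, b). x \<oplus> (w \<oplus> b)) ` (?W \<times> ?B)"
  proof
    fix y assume "y \<in> {y\<in>Pow {..<d}. emd d (orbit s d cs x) (orbit s d cs y) \<le> R}"
    then have y: "y \<subseteq> {..<d}" "emd d (orbit s d cs x) (orbit s d cs y) \<le> R" by auto
    have "\<not> (\<forall>w\<in>?W. t + 1 \<le> card (x \<oplus> (y \<oplus> w)))"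
    proof
      assume "\<forall>w\<in>?W. t + 1 \<le> card (x \<oplus> (y \<oplus> w))"
      then have "2 ^ length cs * real (t + 1) \<le> emd d (orbit s d cs x) (orbit s d cs y)"
        by (intro emd_orbit_ge[OF s cs x y(1)]) auto
      then show False using y(2) R by (simp add: algebra_simps)
    qed
    then obtain w where w: "w \<in> ?W" "card (x \<oplus> (y \<oplus> w)) \<le> t" by force
    have "w \<subseteq> {..<d}" using w span_list_subset[OF cs] by blast
    then have "x \<oplus> (y \<oplus> w) \<in> ?B" using w x y by (simp add: symd_subset)
    moreover have "y = x \<oplus> (w \<oplus> (x \<oplus> (y \<oplus> w)))" by (simp add: symd_ac)
    ultimately show "y \<in> (\<lambda>(w, b). x \<oplus> (w \<oplus> b)) ` (?W \<times> ?B)" using w(1) by force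
  qed
  then have "card {y\<in>Pow {..<d}. emd d (orbit s d cs x) (orbit s d cs y) \<le> R} \<le> card (?W \<times> ?B)"
    by (intro surj_card_le) auto
  also have "\<dots> \<le> 2 ^ length cs * card ?B"
    using card_length[of "span_list cs"] by (simp add: card_cartesian_product length_span_list)
  finally show ?thesis .
qed

section \<open>Collision probabilities\<close>

text \<open>Grouping the points by their value under \<open>g\<close> turns the form into a sum of
  squares of class weights.\<close>

lemma collision_form_nonneg:
  fixes f :: "'a \<Rightarrow> real"
  assumes "finite Q"
  shows "0 \<le> (\<Sum>x\<in>Q. \<Sum>y\<in>Q. f x * f y * (if g x = g y then 1 else 0))"
proof -
  define T where "T u = (\<Sum>x\<in>{x. x \<in> Q \<and> g x = u}. f x)" for u
  have "(\<Sum>y\<in>Q. f x * f y * (if g x = g y then 1 else 0)) = f x * T (g x)" for x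
  proof -
    have "(\<Sum>y\<in>Q. f x * f y * (if g x = g y then 1 else 0)) = f x * (\<Sum>y\<in>Q. if g y = g x then f y else 0)"
      unfolding sum_distrib_left by (intro sum.cong) auto
    also have "(\<Sum>y\<in>Q. if g y = g x then f y else 0) = T (g x)"
      using assms by (simp add: T_def sum.If_cases Int_def)
    finally show ?thesis .
  qed
  then have "(\<Sum>x\<in>Q. \<Sum>y\<in>Q. f x * f y * (if g x = g y then 1 else 0)) = (\<Sum>x\<in>Q. f x * T (g x))"
    by simp
  also have "\<dots> = (\<Sum>u\<in>g ` Q. \<Sum>x\<in>{x. x \<in> Q \<and> g x = u}. f x * T (g x))"
    by (rule sum.image_gen[OF assms])
  also have "\<dots> = (\<Sum>u\<in>g ` Q. T u * T u)"
    by (intro sum.cong) (simp_all add: T_def sum_distrib_right)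
  finally show ?thesis by (simp add: sum_nonneg)
qed

text \<open>The form is nonnegative for each fixed \<open>h\<close>, hence also after integration
  over \<open>h\<close>.\<close>

lemma collision_prob_psd:
  assumes D: "hash_family s d D" and "finite Q" and X: "\<And>x. x \<in> Q \<Longrightarrow> X x \<in> EMD_space s d"
  shows "0 \<le> (\<Sum>x\<in>Q. \<Sum>y\<in>Q. f x * f y * \<P>(h in D. h (X x) = h (X y)))"
proof -
  interpret prob_space D using D by (simp add: hash_family_def)
  define A where "A x y = {h\<in>space D. h (X x) = h (X y)}" for x y
  have A: "A x y \<in> sets D" if "x \<in> Q" "y \<in> Q" for x y
    using D X that by (simp add: A_def hash_family_def)
  have int: "integrable D (\<lambda>h. f x * f y * indicator (A x y) h)" if "x \<in> Q" "y \<in> Q" for x y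
    using A[OF that] by (intro integrable_mult_right integrable_real_indicator) (auto simp: emeasure_eq_measure)
  have "(\<Sum>x\<in>Q. \<Sum>y\<in>Q. f x * f y * \<P>(h in D. h (X x) = h (X y)))
      = (\<Sum>x\<in>Q. \<Sum>y\<in>Q. \<integral>h. f x * f y * indicator (A x y) h \<partial>D)"
    using A by (intro sum.cong refl) (auto simp: A_def)
  also have "\<dots> = (\<integral>h. (\<Sum>x\<in>Q. \<Sum>y\<in>Q. f x * f y * indicator (A x y) h) \<partial>D)"
    using int by (simp add: Bochner_Integration.integral_sum)
  also have "\<dots> \<ge> 0"
  proof (rule integral_nonneg_AE, rule AE_I2)
    fix h assume "h \<in> space D"
    then have "indicator (A x y) h = (if h (X x) = h (X y) then 1 else 0 :: real)" for x y
      by (auto simp: A_def)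
    then show "0 \<le> (\<Sum>x\<in>Q. \<Sum>y\<in>Q. f x * f y * indicator (A x y) h)"
      using collision_form_nonneg[OF assms(2), of f "\<lambda>x. h (X x)"] by simp
  qed
  finally show ?thesis .
qed

section \<open>From the second sensitivity condition to averages of the collision kernel\<close>

lemma finite_EMD_space: "finite (EMD_space s d)"
proof -
  have "finite (cube d)" by (simp add: cube_def finite_PiE)
  then have "finite {xs. set xs \<subseteq> cube d \<and> length xs = s}" by (rule finite_lists_length_eq)
  moreover have "EMD_space s d \<subseteq> mset ` {xs. set xs \<subseteq> cube d \<and> length xs = s}"
  proof
    fix x assume x: "x \<in> EMD_space s d"
    obtain xs where "x = mset xs" by (metis ex_mset)
    then show "x \<in> mset ` {xs. set xs \<subseteq> cube d \<and> length xs = s}"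
      using x by (auto simp: EMD_space_def)
  qed
  ultimately show ?thesis by (meson finite_imageI finite_subset)
qed

text \<open>The event is a finite disjoint union of rectangles, one for each far \<open>y\<close>,
  and the product measure factors on each.\<close>

lemma far_collision_prob:
  assumes D: "hash_family s d D" and x: "x \<in> EMD_space s d"
  shows "\<P>((h, y) in D \<Otimes>\<^sub>M measure_pmf \<mu>. y \<in> EMD_space s d \<and> emd d x y > R \<and> h x = h y)
    = (\<Sum>y\<in>{y\<in>EMD_space s d. emd d x y > R}. \<P>(h in D. h x = h y) * pmf \<mu> y)"
proof -
  interpret prob_space D using D by (simp add: hash_family_def)
  interpret P: pair_prob_space D "measure_pmf \<mu>" ..
  define Y where "Y = {y\<in>EMD_space s d. emd d x y > R}"
  define A where "A y = {h\<in>space D. h x = h y} \<times> {y}" for y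
  have meas: "{h\<in>space D. h x = h y} \<in> sets D" if "y \<in> Y" for y
    using D x that by (auto simp: Y_def hash_family_def)
  have "{w \<in> space (D \<Otimes>\<^sub>M measure_pmf \<mu>). case w of (h, y) \<Rightarrow>
      y \<in> EMD_space s d \<and> emd d x y > R \<and> h x = h y} = (\<Union>y\<in>Y. A y)"
    by (auto simp: space_pair_measure A_def Y_def)
  also have "P.prob (\<Union>y\<in>Y. A y) = (\<Sum>y\<in>Y. P.prob (A y))"
  proof (rule P.finite_measure_finite_Union)
    show "finite Y" using finite_EMD_space by (simp add: Y_def)
    show "A ` Y \<subseteq> sets (D \<Otimes>\<^sub>M measure_pmf \<mu>)"
      using meas by (auto simp: A_def)
    show "disjoint_family_on A Y" by (auto simp: disjoint_family_on_def A_def)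
  qed
  also have "\<dots> = (\<Sum>y\<in>Y. \<P>(h in D. h x = h y) * pmf \<mu> y)"
  proof (rule sum.cong[OF refl])
    fix y assume "y \<in> Y"
    then have "emeasure (D \<Otimes>\<^sub>M measure_pmf \<mu>) (A y)
        = emeasure D {h\<in>space D. h x = h y} * emeasure (measure_pmf \<mu>) {y}"
      unfolding A_def by (intro measure_pmf.emeasure_pair_measure_Times meas) auto
    then show "P.prob (A y) = \<P>(h in D. h x = h y) * pmf \<mu> y"
      by (simp add: measure_def enn2real_mult pmf.rep_eq)
  qed
  finally show ?thesis by (simp add: Y_def case_prod_unfold)
qed

text \<open>Sensitivity for the image under \<open>X\<close> of the uniform law on \<open>Q\<close>
  controls the far points; each near point contributes at most 1.\<close>

lemma avg_collision_le:
  fixes X :: "'b \<Rightarrow> (nat \<Rightarrow> real) multiset" and R p2 :: real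
  assumes D: "hash_family s d D" and Q: "finite Q" "Q \<noteq> {}"
    and X: "\<And>y. y \<in> Q \<Longrightarrow> X y \<in> EMD_space s d" and x: "x \<in> EMD_space s d"
    and p2: "\<P>((h, y) in D \<Otimes>\<^sub>M measure_pmf (map_pmf X (pmf_of_set Q)).
      y \<in> EMD_space s d \<and> emd d x y > R \<and> h x = h y) \<le> p2"
  shows "(\<Sum>y\<in>Q. \<P>(h in D. h x = h (X y))) \<le> card Q * p2 + card {y\<in>Q. emd d x (X y) \<le> R}"
proof -
  interpret prob_space D using D by (simp add: hash_family_def)
  let ?\<phi> = "\<lambda>y. \<P>(h in D. h x = h y)"
  let ?Y = "{y\<in>EMD_space s d. emd d x y > R}"
  let ?far = "\<lambda>y. if y \<in> ?Y then ?\<phi> y else 0"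
  have "(\<Sum>y\<in>?Y. ?\<phi> y * pmf (map_pmf X (pmf_of_set Q)) y)
      = (\<Sum>y\<in>?Y. ?far y * pmf (map_pmf X (pmf_of_set Q)) y)"
    by (intro sum.cong) auto
  also have "\<dots> = measure_pmf.expectation (map_pmf X (pmf_of_set Q)) ?far"
    using finite_EMD_space
    by (intro integral_measure_pmf_real[symmetric]) (auto split: if_splits)
  also have "\<dots> = (\<Sum>y\<in>Q. ?far (X y)) / card Q"
    using Q by (simp add: integral_pmf_of_set)
  finally have "(\<Sum>y\<in>Q. ?far (X y)) / card Q \<le> p2"
    using p2 far_collision_prob[OF D x] by simp
  moreover have "0 < card Q" using Q by (simp add: card_gt_0_iff)
  ultimately have far: "(\<Sum>y\<in>Q. ?far (X y)) \<le> card Q * p2" by (simp add: field_simps)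
  have "(\<Sum>y\<in>Q. ?\<phi> (X y)) \<le> (\<Sum>y\<in>Q. ?far (X y) + (if emd d x (X y) \<le> R then 1 else 0))"
    using X by (intro sum_mono) auto
  also have "\<dots> = (\<Sum>y\<in>Q. ?far (X y)) + card {y\<in>Q. emd d x (X y) \<le> R}"
    using Q by (simp add: sum.distrib sum.If_cases Int_def)
  finally show ?thesis using far by simp
qed

section \<open>Choice of parameters\<close>

text \<open>This is \<open>card_small_subsets\<close> at \<open>x = 1 / 4\<close>. The constants
  come from \<open>4 \<le> (119 / 100) ^ 8\<close> and
  \<open>25 / 16 * (119 / 100) \<le> 93 / 50\<close>; what matters is that the base stays below
  2.\<close>

lemma card_ball_le: "real (card {b\<in>Pow {..<2 * m}. card b \<le> m div 8}) \<le> (93 / 50) ^ m"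
proof -
  let ?t = "m div 8" and ?V = "real (card {b\<in>Pow {..<2 * m}. card b \<le> m div 8})"
  have "(4::real) ^ ?t \<le> ((119 / 100) ^ 8) ^ ?t"
    by (intro power_mono) (simp_all add: power_divide)
  also have "\<dots> \<le> (119 / 100) ^ m"
    unfolding power_mult[symmetric] by (intro power_increasing) auto
  finally have four: "(4::real) ^ ?t \<le> (119 / 100) ^ m" .
  have "?V = ?V * (1 / 4) ^ ?t * 4 ^ ?t" by (simp add: power_divide)
  also have "\<dots> \<le> (1 + 1 / 4) ^ card {..<2 * m} * 4 ^ ?t"
    by (intro mult_right_mono card_small_subsets) auto
  also have "(1 + 1 / 4 :: real) ^ card {..<2 * m} = (25 / 16) ^ m"
    by (simp add: power_mult power_divide)
  also have "(25 / 16) ^ m * 4 ^ ?t \<le> (25 / 16 :: real) ^ m * (119 / 100) ^ m"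
    using four by (intro mult_left_mono) auto
  also have "\<dots> = (25 / 16 * (119 / 100)) ^ m" by (simp only: power_mult_distrib)
  also have "\<dots> \<le> (93 / 50) ^ m" by (intro power_mono) auto
  finally show ?thesis .
qed

lemma gap_bound:
  fixes R p1 p2 :: real
  assumes m: "m > 0" and s: "2 ^ m \<le> s" and R: "R < 2 ^ m * (m / 8)"
    and hash: "\<And>\<mu>. set_pmf \<mu> \<subseteq> EMD_space s (2 * m) \<Longrightarrow>
      \<exists>D :: ((nat \<Rightarrow> real) multiset \<Rightarrow> 'u) measure. sensitive s (2 * m) \<mu> D (2 ^ m * real k) R p1 p2"
  shows "p1 \<le> p2 + (93 / 100) ^ m + (15 / 16) ^ k"
proof -
  define d where "d = 2 * m"
  define t where "t = m div 8"
  let ?Q = "Pow {..<d}" and ?V = "card {b\<in>Pow {..<d}. card b \<le> t}"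
  have card_Q: "card ?Q = 2 ^ d" by (simp add: card_Pow)
  have V: "real ?V \<le> (93 / 50) ^ m" using card_ball_le[of m] by (simp add: d_def t_def)
  have "(93 / 50 :: real) ^ m < 2 ^ m" using m by (intro power_strict_mono) auto
  then have "real ?V < 2 ^ m" using V by linarith
  then have V2: "?V < 2 ^ m" by (rule of_nat_less_numeral_power_cancel_iff[THEN iffD1])
  \<comment> \<open>Separating these sets makes every nonzero word of the dual code have more than
    \<open>m div 8\<close> elements.\<close>
  define B where "B = {S\<in>?Q. card S \<le> t} - {{}}"
  have "card B \<le> ?V" unfolding B_def by (intro card_mono) auto
  then have "card B < 2 ^ m" using V2 by simp
  moreover have "B \<subseteq> ?Q - {{}}" by (auto simp: B_def)
  ultimately obtain cs where cs: "length cs = m" "set cs \<subseteq> ?Q"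
      "\<forall>S\<in>B. \<exists>c\<in>set cs. odd (card (S \<inter> c))"
    using exists_odd_basis[of "{..<d}" B m] by auto
  define X where "X = orbit s d cs"
  have s': "2 ^ length cs \<le> s" using s cs by simp
  have X: "X y \<in> EMD_space s d" for y
    unfolding X_def by (rule orbit_in_EMD_space[OF s'])
  \<comment> \<open>The hard distribution is the orbit of a uniformly random point of the
    cube.\<close>
  obtain D :: "((nat \<Rightarrow> real) multiset \<Rightarrow> 'u) measure"
    where D: "sensitive s d (map_pmf X (pmf_of_set ?Q)) D (2 ^ m * real k) R p1 p2"
    using hash[of "map_pmf X (pmf_of_set ?Q)"] X by (auto simp: d_def)
  have hf: "hash_family s d D" using D by (simp add: sensitive_def)
  interpret prob_space D using hf by (simp add: hash_family_def)
  define K where "K x y = \<P>(h in D. h (X x) = h (X y))" for x y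
  have "p1 \<le> (\<Sum>x\<in>?Q. \<Sum>y\<in>?Q. K x y) / 4 ^ d + (1 - 1 / 16) ^ k"
  proof (rule kernel_bound[where C = "set cs"])
    show "0 \<le> (\<Sum>x\<in>?Q. \<Sum>y\<in>?Q. f x * f y * K x y)" for f
      unfolding K_def by (rule collision_prob_psd[OF hf]) (auto simp: X)
    show "K x x = 1" for x by (simp add: K_def prob_space)
    show "K x (c \<oplus> y) = K x y" if "c \<in> set cs" for x y c
      using orbit_shift[OF that] by (simp add: K_def X_def)
    show "\<exists>c\<in>set cs. odd (card (S \<inter> c))" if "S \<subseteq> {..<d}" "S \<noteq> {}" "card S < 1 / 16 * d" for S
    proof -
      have "card S \<le> t" using that by (simp add: d_def t_def less_eq_div_iff_mult_less_eq)
      then show ?thesis using cs that by (simp add: B_def)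
    qed
    show "p1 \<le> K x (x \<oplus> z)" if "x \<subseteq> {..<d}" "z \<subseteq> {..<d}" "card z \<le> k" for x z
    proof -
      have "emd d (X x) (X (x \<oplus> z)) \<le> 2 ^ m * card z"
        using emd_orbit_le[OF s' cs(2) that(1,2)] cs(1) by (simp add: X_def)
      also have "\<dots> \<le> 2 ^ m * real k" using that by simp
      finally show ?thesis using D X by (simp add: sensitive_def K_def)
    qed
  qed (use m cs in \<open>auto simp: d_def\<close>)
  moreover have "(\<Sum>x\<in>?Q. \<Sum>y\<in>?Q. K x y) \<le> (\<Sum>x\<in>?Q. 2 ^ d * p2 + 2 ^ m * (93 / 50) ^ m)"
  proof (rule sum_mono)
    fix x assume x: "x \<in> ?Q"
    have "(\<Sum>y\<in>?Q. K x y) \<le> card ?Q * p2 + card {y\<in>?Q. emd d (X x) (X y) \<le> R}"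
      unfolding K_def
      using avg_collision_le[OF hf, of ?Q X "X x" R p2] D X by (auto simp: sensitive_def)
    also have "card {y\<in>?Q. emd d (X x) (X y) \<le> R} \<le> 2 ^ m * ?V"
    proof -
      \<comment> \<open>Rounding \<open>m / 8\<close> down to \<open>t\<close> is made up for by the
        \<open>t + 1\<close> in \<open>card_near_orbits\<close>.\<close>
      have "m < 8 * (t + 1)" by (simp add: t_def)
      then have "real m < real (8 * (t + 1))" by (simp only: of_nat_less_iff)
      then have "real m / 8 \<le> real (t + 1)" by simp
      then have "2 ^ m * (m / 8) \<le> 2 ^ m * real (t + 1)" by (intro mult_left_mono) auto
      then have "R < 2 ^ m * real (t + 1)" using R by linarith
      then have "R < 2 ^ length cs * (real t + 1)" using cs(1) by (simp add: algebra_simps)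
      from card_near_orbits[OF s' cs(2) _ this, of x] show ?thesis
        using x cs(1) by (simp add: X_def)
    qed
    also have "real (2 ^ m * ?V) \<le> 2 ^ m * (93 / 50) ^ m" using V by simp
    finally show "(\<Sum>y\<in>?Q. K x y) \<le> 2 ^ d * p2 + 2 ^ m * (93 / 50) ^ m"
      by (simp add: card_Q)
  qed
  \<comment> \<open>As \<open>2 ^ d = 4 ^ m\<close>, the near points make up at most the fraction
    \<open>2 ^ m * (93 / 50) ^ m / 4 ^ m\<close> of the cube.\<close>
  moreover have "(\<Sum>x\<in>?Q. 2 ^ d * p2 + 2 ^ m * (93 / 50) ^ m) / 4 ^ d = p2 + (93 / 100) ^ m"
  proof -
    have "(4::real) ^ d = 2 ^ d * 2 ^ d" by (simp flip: power_mult_distrib)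
    moreover have "(2::real) ^ d = 2 ^ m * 2 ^ m" by (simp add: d_def power_mult power2_eq_square flip: power_mult_distrib)
    moreover have "(93 / 50 :: real) ^ m = (93 / 100) ^ m * 2 ^ m" by (simp flip: power_mult_distrib)
    ultimately show ?thesis by (simp add: card_Q field_simps)
  qed
  ultimately have "p1 \<le> p2 + (93 / 100) ^ m + (1 - 1 / 16) ^ k"
    using divide_right_mono[of "\<Sum>x\<in>?Q. \<Sum>y\<in>?Q. K x y" _ "4 ^ d"] by force
  then show ?thesis by simp
qed

theorem theorem8p3:
  fixes p1 p2 :: real
  assumes "0 < p2" and "p2 < p1" and "p1 < 1"
  shows "\<exists>K>0. \<exists>s0::nat. \<forall>c :: nat \<Rightarrow> real.
    (\<forall>s. c s > 1) \<longrightarrow>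
    (\<forall>s d. \<forall>r>0. \<forall>\<mu>. set_pmf \<mu> \<subseteq> EMD_space s d \<longrightarrow>
      (\<exists>D :: ((nat \<Rightarrow> real) multiset \<Rightarrow> 'u) measure. sensitive s d \<mu> D r (c s * r) p1 p2)) \<longrightarrow>
    (\<forall>s\<ge>s0. c s \<ge> K * ln (real s))"
proof -
  \<comment> \<open>A quarter of the gap, so that the two error terms together stay below half of
    it.\<close>
  define \<epsilon> where "\<epsilon> = (p1 - p2) / 4"
  have \<epsilon>: "\<epsilon> > 0" using assms by (simp add: \<epsilon>_def)
  obtain k0 where k0: "(15 / 16 :: real) ^ k0 < \<epsilon>" using real_arch_pow_inv[OF \<epsilon>, of "15 / 16"] by auto
  \<comment> \<open>The number of noise steps depends on \<open>p1\<close> and \<open>p2\<close>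
    only. The successor makes it positive, as the radius \<open>2 ^ m * k\<close> must be.\<close>
  define k where "k = Suc k0"
  have "(15 / 16 :: real) ^ k \<le> (15 / 16) ^ k0"
    unfolding k_def by (intro power_decreasing) auto
  then have k: "(15 / 16 :: real) ^ k < \<epsilon>" "k > 0"
    using k0 by (auto simp only: k_def)
  obtain m0 where m0: "(93 / 100 :: real) ^ m0 < \<epsilon>" using real_arch_pow_inv[OF \<epsilon>, of "93 / 100"] by auto
  show ?thesis
  \<comment> \<open>The constant combines \<open>c s * k \<ge> m / 8\<close>, forced by
    \<open>gap_bound\<close>, with \<open>ln s \<le> 2 * m\<close>. The threshold ensures
    \<open>m > m0\<close>, so that \<open>m > 0\<close> and
    \<open>(93 / 100) ^ m < \<epsilon>\<close>.\<close>
  proof (intro exI[of _ "1 / (16 * real k)"] conjI exI[of _ "2 ^ Suc m0"] allI impI)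
    show "0 < 1 / (16 * real k)" using k by simp
    fix c :: "nat \<Rightarrow> real" and s :: nat
    assume hash: "\<forall>s d. \<forall>r>0. \<forall>\<mu>. set_pmf \<mu> \<subseteq> EMD_space s d \<longrightarrow>
      (\<exists>D :: ((nat \<Rightarrow> real) multiset \<Rightarrow> 'u) measure. sensitive s d \<mu> D r (c s * r) p1 p2)"
    assume s0: "2 ^ Suc m0 \<le> s"
    then have "s > 0" by (metis gr0I le_zero_eq power_not_zero zero_neq_numeral)
    then obtain m where m: "2 ^ m \<le> s" "s < 2 ^ (m + 1)"
      using ex_power_ivl1[of 2 s] by auto
    have "(2::nat) ^ Suc m0 < 2 ^ (m + 1)" using s0 m by linarith
    then have "Suc m0 < m + 1" by (simp only: power_strict_increasing_iff)
    then have mm: "m0 \<le> m" "m > 0" by auto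
    have "real s \<le> 2 ^ (m + 1)"
      using m(2) by (intro of_nat_le_numeral_power_cancel_iff[THEN iffD2]) simp
    then have "ln (real s) \<le> ln (2 ^ (m + 1))"
      using \<open>s > 0\<close> by (subst ln_le_cancel_iff) auto
    also have "\<dots> = (m + 1) * ln 2" by (subst ln_realpow) auto
    also have "\<dots> \<le> real (m + 1) * 1" using ln_le_minus_one[of 2] by (intro mult_left_mono) auto
    also have "\<dots> \<le> 2 * m" using mm by simp
    finally have ln_s: "ln (real s) \<le> 2 * m" .
    show "1 / (16 * real k) * ln (real s) \<le> c s"
    proof (rule ccontr)
      \<comment> \<open>A smaller \<open>c s\<close> puts the far radius below
        \<open>2 ^ m * (m / 8)\<close>, where \<open>gap_bound\<close> contradicts the gap between
        \<open>p1\<close> and \<open>p2\<close>.\<close>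
      assume "\<not> ?thesis"
      then have "c s * k < ln (real s) / 16" using k by (simp add: field_simps)
      also have "\<dots> \<le> m / 8" using ln_s by simp
      finally have R: "c s * (2 ^ m * real k) < 2 ^ m * (m / 8)" by (simp add: field_simps)
      have "p1 \<le> p2 + (93 / 100) ^ m + (15 / 16) ^ k"
      proof (rule gap_bound[OF mm(2) m(1) R])
        fix \<mu> assume \<mu>: "set_pmf \<mu> \<subseteq> EMD_space s (2 * m)"
        have "0 < 2 ^ m * real k" using k by simp
        then show "\<exists>D :: ((nat \<Rightarrow> real) multiset \<Rightarrow> 'u) measure.
            sensitive s (2 * m) \<mu> D (2 ^ m * real k) (c s * (2 ^ m * real k)) p1 p2"
          using hash \<mu> by blast
      qed
      also have "\<dots> < p2 + \<epsilon> + \<epsilon>"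
      proof (rule add_strict_mono[OF add_strict_left_mono k(1)])
        have "(93 / 100 :: real) ^ m \<le> (93 / 100) ^ m0"
          using mm by (intro power_decreasing) auto
        then show "(93 / 100 :: real) ^ m < \<epsilon>" using m0 by (rule le_less_trans)
      qed
      finally show False using \<epsilon> by (simp add: \<epsilon>_def field_simps)
    qed
  qed
qed

end
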